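(* If a nonzero function $\varphi\in L^2(\mathbb{R})$ has compact support, then $\mathfrak{S}(\varphi)$ has invariance order one. That is, $\mathfrak{S}(\varphi)$ is not $\frac1n\mathbb{Z}$-invariant for any integer $n>1$.
   Context: $T_a f(x) = f(x-a)$. $\mathfrak{S}(\varphi) = \overline{\mathrm{span}}\{T_j \varphi : j \in\mathbb{Z}\}$ (closure in $L^2(\mathbb{R})$) is the shift-invariant space generated by $\varphi$. A closed subspace $S$ of $L^2(\mathbb{R})$ is $\frac1n\mathbb{Z}$-invariant if $T_{k/n}f\in S$ for all $f\in S$, $k\in\mathbb{Z}$. A shift-invariant space (closed subspace of $L^2(\mathbb{R})$ invariant under integer translations) has invariance order $n$ if $n$ is the maximum positive integer such that it is $\frac1n\mathbb{Z}$-invariant, and invariance order $\infty$ if this maximum does not exist. *)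

theory Defs
  imports "HOL-Analysis.Analysis" "HOL-Library.Extended_Nat"
begin

text \<open>
  Elements of $L^2(\mathbb{R})$ are represented by complex-valued Lebesgue measurable functions
  rather than by almost-everywhere classes.  Equality in $L^2$ is thus equality almost everywhere,
  and every set of the form \<open>L2_closure A\<close> below is saturated under it.
\<close>

definition L2 :: "(real \<Rightarrow> complex) set" where
  "L2 = {f \<in> borel_measurable lebesgue. integrable lebesgue (\<lambda>x. (cmod (f x))\<^sup>2)}"

definition L2_norm :: "(real \<Rightarrow> complex) \<Rightarrow> real" where
  "L2_norm f = sqrt (LINT x|lebesgue. (cmod (f x))\<^sup>2)"

definition L2_closure :: "(real \<Rightarrow> complex) set \<Rightarrow> (real \<Rightarrow> complex) set" where
  "L2_closure A = {f \<in> L2. \<forall>e>0. \<exists>g\<in>A. L2_norm (\<lambda>x. f x - g x) < e}"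

definition complex_span :: "(real \<Rightarrow> complex) set \<Rightarrow> (real \<Rightarrow> complex) set" where
  "complex_span A = {\<lambda>x. \<Sum>g\<in>F. c g * g x | F c. finite F \<and> F \<subseteq> A}"

text \<open>
  The support of a class in $L^2$: the complement of the largest open set on which the function
  vanishes almost everywhere, hence independent of the representative.
\<close>

definition ess_support :: "(real \<Rightarrow> complex) \<Rightarrow> real set" where
  "ess_support f = - \<Union>{U. open U \<and> (AE x in lebesgue. x \<in> U \<longrightarrow> f x = 0)}"

definition translate :: "real \<Rightarrow> (real \<Rightarrow> complex) \<Rightarrow> (real \<Rightarrow> complex)" where
  "translate a f = (\<lambda>x. f (x - a))"

definition generated_sis :: "(real \<Rightarrow> complex) \<Rightarrow> (real \<Rightarrow> complex) set" where
  "generated_sis \<phi> = L2_closure (complex_span {translate (of_int j) \<phi> | j. True})"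

text \<open>
  The next two notions are meant for closed subspaces, respectively shift-invariant spaces; this is
  not built into the definitions, so that the negation of invariance only speaks about translates.
\<close>

definition frac_invariant :: "nat \<Rightarrow> (real \<Rightarrow> complex) set \<Rightarrow> bool" where
  "frac_invariant n S \<longleftrightarrow> (\<forall>f\<in>S. \<forall>k::int. translate (of_int k / of_nat n) f \<in> S)"

definition invariance_order :: "(real \<Rightarrow> complex) set \<Rightarrow> enat" where
  "invariance_order S =
    (let N = {n. n > 0 \<and> frac_invariant n S}
     in if \<exists>m\<in>N. \<forall>n\<in>N. n \<le> m then enat (GREATEST n. n \<in> N) else \<infinity>)"

end

theory Submission
  imports Defs "HOL-Computational_Algebra.Formal_Power_Series"
begin

text \<open>
  Invariance under $\frac1n\mathbb{Z}$ puts the translate of \<open>\<phi>\<close> by $1/n$ into the shift-invariant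
  space, so that it is an $L^2$-limit, and along a subsequence an almost everywhere limit, of
  functions $\sum_j p_m(j)\,\varphi(x-j)$.  For fixed $x$, such a function restricted to the grid
  $x+\mathbb{Z}$ is the convolution of \<open>p\<^sub>m\<close> with the sequence $k \mapsto \varphi(x+k)$, which
  is finitely supported because \<open>\<phi>\<close> has compact support; and \<open>p\<^sub>m\<close> is the same for
  all $x$.  Heuristically, then, the generating Laurent polynomial
  $F_x(z)=\sum_k \varphi(x+k)z^k$
  satisfies $F_{x-1/n} = r F_x$ with a ratio $r$ that does not depend on $x$.  The sequence
  \<open>p\<^sub>m\<close> need not converge in any useful sense, but the ratio can be eliminated: convolution
  with a finitely supported sequence commutes with pointwise limits, whence
  \[ F_{x-1/n}\,F_y = F_{y-1/n}\,F_x \]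
  for all $x$, $y$ in a set of full measure (lemma \<open>convolution_limits_exchange\<close>).

  Choosing $x$ and $y$ among $x_0, x_0-\frac1n, x_0-\frac2n,\dots$ with $F_{x_0} \neq 0$, one finds
  that the Laurent polynomials $F_{x_0-i/n}$ form a geometric progression with ratio
  $r=F_{x_0-1/n}/F_{x_0}$.  On the other hand $F_{x_0-1} = zF_{x_0}$, hence $r^n = z$.  Comparing
  orders of vanishing at $z=0$ gives $n \mid 1$
  (lemma \<open>no_nth_root_of_X_in_geometric_progression\<close>).
\<close>

section \<open>Translations and $L^2$\<close>

lemma translate_translate: "translate a (translate b f) = translate (a + b) f"
  by (simp add: translate_def diff_diff_eq)

lemma translate_L2:
  assumes "f \<in> L2"
  shows "translate a f \<in> L2"
proof -
  have f: "f \<in> borel_measurable lebesgue" "integrable lebesgue (\<lambda>x. (cmod (f x))\<^sup>2)"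
    using assms by (auto simp: L2_def)
  have "(\<lambda>x. x - a) \<in> lebesgue \<rightarrow>\<^sub>M lebesgue"
    using lebesgue_affine_measurable[of "\<lambda>_. 1::real" "-a"] by simp
  then have "(\<lambda>x. f (x - a)) \<in> borel_measurable lebesgue"
    by (rule measurable_compose) (rule f)
  moreover have "integrable lebesgue (\<lambda>x. (cmod (f (x - a)))\<^sup>2)"
    using lebesgue_integrable_real_affine[OF f(2), of 1 "-a"] by simp
  ultimately show ?thesis
    unfolding L2_def translate_def by blast
qed

lemma L2_norm_translate: "L2_norm (translate a f) = L2_norm f"
  using lebesgue_integral_real_affine[of 1 "\<lambda>x. (cmod (f x))\<^sup>2" "-a"]
  by (simp add: L2_norm_def translate_def)

lemma L2_add:
  assumes "f \<in> L2" "g \<in> L2"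
  shows "(\<lambda>x. f x + g x) \<in> L2"
proof -
  have m [measurable]: "f \<in> borel_measurable lebesgue" "g \<in> borel_measurable lebesgue"
    and i: "integrable lebesgue (\<lambda>x. (cmod (f x))\<^sup>2)" "integrable lebesgue (\<lambda>x. (cmod (g x))\<^sup>2)"
    using assms by (auto simp: L2_def)
  have "integrable lebesgue (\<lambda>x. (cmod (f x + g x))\<^sup>2)"
  proof (rule Bochner_Integration.integrable_bound)
    show "integrable lebesgue (\<lambda>x. 2 * (cmod (f x))\<^sup>2 + 2 * (cmod (g x))\<^sup>2)"
      using i by auto
    have "(cmod (a + b))\<^sup>2 \<le> 2 * (cmod a)\<^sup>2 + 2 * (cmod b)\<^sup>2" for a b
    proof -
      have "(cmod (a + b))\<^sup>2 \<le> (cmod a + cmod b)\<^sup>2"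
        by (simp add: norm_triangle_ineq power_mono)
      also have "\<dots> \<le> 2 * (cmod a)\<^sup>2 + 2 * (cmod b)\<^sup>2"
        using zero_le_power2[of "cmod a - cmod b"] by (simp add: power2_eq_square algebra_simps)
      finally show ?thesis .
    qed
    then show "AE x in lebesgue. norm ((cmod (f x + g x))\<^sup>2)
        \<le> norm (2 * (cmod (f x))\<^sup>2 + 2 * (cmod (g x))\<^sup>2)"
      by simp
  qed measurable
  then show ?thesis
    by (simp add: L2_def)
qed

lemma L2_scale:
  assumes "f \<in> L2"
  shows "(\<lambda>x. c * f x) \<in> L2"
  using assms by (auto simp: L2_def norm_mult power_mult_distrib)

lemma L2_diff:
  assumes "f \<in> L2" "g \<in> L2"
  shows "(\<lambda>x. f x - g x) \<in> L2"
  using L2_add[OF assms(1) L2_scale[OF assms(2), of "-1"]] by simp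

lemma complex_span_subset_L2:
  assumes "A \<subseteq> L2"
  shows "complex_span A \<subseteq> L2"
proof -
  have "(\<lambda>x. \<Sum>g\<in>F. c g * g x) \<in> L2" if "finite F" "F \<subseteq> A" for F c
    using that
  proof (induction F rule: finite_induct)
    case empty
    show ?case by (simp add: L2_def)
  next
    case (insert h F)
    then show ?case
      using assms by (auto intro!: L2_add L2_scale)
  qed
  then show ?thesis
    by (auto simp: complex_span_def)
qed

lemma L2_closure_AE_limit:
  assumes "f \<in> L2_closure A" "A \<subseteq> L2"
  obtains g where "\<And>m. g m \<in> A" "AE x in lebesgue. (\<lambda>m. g m x) \<longlonglongrightarrow> f x"
proof -
  have f: "f \<in> L2" and "\<forall>m. \<exists>g\<in>A. L2_norm (\<lambda>x. f x - g x) < 1 / real (Suc m)"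
    using assms by (auto simp: L2_closure_def)
  then obtain g where g: "\<And>m. g m \<in> A" "\<And>m. L2_norm (\<lambda>x. f x - g m x) < 1 / real (Suc m)"
    by metis
  define u where "u m x = (cmod (f x - g m x))\<^sup>2" for m x
  have "(\<lambda>m. L2_norm (\<lambda>x. f x - g m x)) \<longlonglongrightarrow> 0"
  proof (rule tendsto_sandwich)
    show "\<forall>\<^sub>F m in sequentially. 0 \<le> L2_norm (\<lambda>x. f x - g m x)"
      by (simp add: L2_norm_def)
    show "\<forall>\<^sub>F m in sequentially. L2_norm (\<lambda>x. f x - g m x) \<le> 1 / real (Suc m)"
      using g(2) by (simp add: less_imp_le)
  qed (auto intro: LIMSEQ_Suc[OF lim_const_over_n[of 1, simplified]] simp del: of_nat_Suc)
  then have "(\<lambda>m. (L2_norm (\<lambda>x. f x - g m x))\<^sup>2) \<longlonglongrightarrow> 0"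
    using tendsto_power[of _ 0 _ 2] by fastforce
  then have "(\<lambda>m. LINT x|lebesgue. norm (u m x)) \<longlonglongrightarrow> 0"
    by (simp add: L2_norm_def u_def)
  moreover have "integrable lebesgue (u m)" for m
    using L2_diff[OF f, of "g m"] g(1) assms(2) by (auto simp: L2_def u_def[abs_def])
  ultimately obtain r where r: "AE x in lebesgue. (\<lambda>m. u (r m) x) \<longlonglongrightarrow> 0"
    using tendsto_L1_AE_subseq[of lebesgue u] by blast
  have "(\<lambda>m. g (r m) x) \<longlonglongrightarrow> f x" if "(\<lambda>m. u (r m) x) \<longlonglongrightarrow> 0" for x
  proof -
    have "(\<lambda>m. sqrt (u (r m) x)) \<longlonglongrightarrow> 0"
      using tendsto_real_sqrt[OF that] by simp
    then have "(\<lambda>m. cmod (g (r m) x - f x)) \<longlonglongrightarrow> 0"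
      by (simp add: u_def norm_minus_commute)
    then show ?thesis
      using LIM_zero_iff tendsto_norm_zero_iff by blast
  qed
  with r have "AE x in lebesgue. (\<lambda>m. g (r m) x) \<longlonglongrightarrow> f x"
    by (auto elim: eventually_mono)
  with g(1) show thesis
    by (intro that[of "\<lambda>m. g (r m)"])
qed

lemma AE_lebesgue_shift:
  fixes a :: real
  assumes "AE x in lebesgue. P x"
  shows "AE x in lebesgue. P (x + a)"
proof -
  have "negligible {x. \<not> P x}"
    using assms by (simp add: completion.AE_iff_null_sets negligible_iff_null_sets)
  then have "negligible ((+) (-a) ` {x. \<not> P x})"
    by (rule negligible_translation)
  moreover have "(+) (-a) ` {x. \<not> P x} = {x. \<not> P (x + a)}"
    by (force simp: image_iff)
  ultimately show ?thesis
    by (simp add: completion.AE_iff_null_sets negligible_iff_null_sets)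
qed

text \<open>
  The complement of the essential support is a union of open sets on each of which \<open>f\<close> vanishes
  almost everywhere; by the Lindeloef property countably many of them suffice.
\<close>
lemma AE_zero_outside_ess_support: "AE x in lebesgue. x \<notin> ess_support f \<longrightarrow> f x = 0"
proof -
  let ?\<U> = "{U. open U \<and> (AE x in lebesgue. x \<in> U \<longrightarrow> f x = 0)}"
  obtain \<V> where V: "\<V> \<subseteq> ?\<U>" "countable \<V>" "\<Union>\<V> = \<Union>?\<U>"
    using Lindelof[of ?\<U>] by auto
  have "AE x in lebesgue. \<forall>U\<in>\<V>. x \<in> U \<longrightarrow> f x = 0"
    using V by (subst AE_ball_countable) auto
  moreover have "x \<notin> ess_support f \<longleftrightarrow> (\<exists>U\<in>\<V>. x \<in> U)" for x
  proof -
    have "x \<notin> ess_support f \<longleftrightarrow> x \<in> \<Union>?\<U>"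
      by (auto simp: ess_support_def)
    then show ?thesis
      unfolding V(3)[symmetric] by blast
  qed
  ultimately show ?thesis
    by (auto elim: eventually_mono)
qed

section \<open>Spaces generated by integer shifts\<close>

lemma complex_span_shifts_sum:
  assumes "g \<in> complex_span {translate (of_int j) \<phi> | j. True}"
  obtains P and p :: "int \<Rightarrow> complex"
  where "finite P" "g = (\<lambda>x. \<Sum>j\<in>P. p j * \<phi> (x - of_int j))"
proof -
  obtain F c where F: "finite F" "F \<subseteq> {translate (of_int j) \<phi> | j. True}"
    and g: "g = (\<lambda>x. \<Sum>h\<in>F. c h * h x)"
    using assms by (auto simp: complex_span_def)
  obtain J :: "_ \<Rightarrow> int" where J: "\<And>h. h \<in> F \<Longrightarrow> h = translate (of_int (J h)) \<phi>"
    using F(2) by (simp add: subset_iff) metis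
  have "inj_on J F"
    using J by (metis inj_onI)
  have "(\<Sum>h\<in>F. c h * h x)
      = (\<Sum>j\<in>J ` F. c (translate (of_int j) \<phi>) * \<phi> (x - of_int j))" for x
  proof -
    have "(\<Sum>j\<in>J ` F. c (translate (of_int j) \<phi>) * \<phi> (x - of_int j))
        = (\<Sum>h\<in>F. c (translate (of_int (J h)) \<phi>) * translate (of_int (J h)) \<phi> x)"
      using \<open>inj_on J F\<close> by (simp add: sum.reindex translate_def)
    also have "\<dots> = (\<Sum>h\<in>F. c h * h x)"
      by (intro sum.cong) (auto simp flip: J)
    finally show ?thesis ..
  qed
  with g F(1) show thesis
    by (intro that[of "J ` F" "\<lambda>j. c (translate (of_int j) \<phi>)"]) auto
qed

lemma complex_span_translate:
  assumes "g \<in> complex_span A" "translate a ` A \<subseteq> A"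
  shows "translate a g \<in> complex_span A"
proof -
  obtain F c where F: "finite F" "F \<subseteq> A" and g: "g = (\<lambda>x. \<Sum>h\<in>F. c h * h x)"
    using assms(1) by (auto simp: complex_span_def)
  have inv: "translate (-a) (translate a h) = h" for h
    by (simp add: translate_translate) (simp add: translate_def)
  then have "inj_on (translate a) F"
    by (metis inj_onI)
  then have "translate a g = (\<lambda>x. \<Sum>h\<in>translate a ` F. c (translate (-a) h) * h x)"
    by (simp add: sum.reindex inv g) (simp add: translate_def)
  moreover have "finite (translate a ` F)" "translate a ` F \<subseteq> A"
    using F assms(2) by auto
  ultimately show ?thesis
    unfolding complex_span_def by (intro CollectI exI conjI)
qed

lemma complex_span_superset: "A \<subseteq> complex_span A"
proof
  fix h assume "h \<in> A"
  then show "h \<in> complex_span A"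
    unfolding complex_span_def
    by (intro CollectI exI[of _ "{h}"] exI[of _ "\<lambda>_. 1"]) simp
qed

lemma L2_closure_superset:
  assumes "f \<in> A" "f \<in> L2"
  shows "f \<in> L2_closure A"
  unfolding L2_closure_def
  by (intro CollectI conjI allI impI bexI[of _ f] assms) (simp add: L2_norm_def)

lemma L2_closure_translate:
  assumes f: "f \<in> L2_closure A" and A: "\<And>g. g \<in> A \<Longrightarrow> translate a g \<in> A"
  shows "translate a f \<in> L2_closure A"
  unfolding L2_closure_def
proof (intro CollectI conjI allI impI)
  show "translate a f \<in> L2"
    using f by (intro translate_L2) (simp add: L2_closure_def)
  fix e :: real assume "e > 0"
  then obtain g where g: "g \<in> A" "L2_norm (\<lambda>x. f x - g x) < e"
    using f by (auto simp: L2_closure_def)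
  have "L2_norm (\<lambda>x. translate a f x - translate a g x) = L2_norm (\<lambda>x. f x - g x)"
    using L2_norm_translate[of a "\<lambda>x. f x - g x"] by (simp add: translate_def)
  with g(2) show "\<exists>g\<in>A. L2_norm (\<lambda>x. translate a f x - g x) < e"
    by (intro bexI[OF _ A[OF g(1)]]) simp
qed

lemma frac_invariant_1_generated_sis: "frac_invariant 1 (generated_sis \<phi>)"
proof -
  let ?A = "{translate (of_int j) \<phi> | j. True}"
  have A: "translate (of_int k / of_nat 1) ` ?A \<subseteq> ?A" for k :: int
  proof
    fix f assume "f \<in> translate (of_int k / of_nat 1) ` ?A"
    then obtain j :: int where "f = translate (of_int k / of_nat 1) (translate (of_int j) \<phi>)"
      by blast
    then have "f = translate (of_int (k + j)) \<phi>"
      by (simp add: translate_translate)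
    then show "f \<in> ?A"
      by blast
  qed
  show ?thesis
    unfolding frac_invariant_def generated_sis_def
    by (intro ballI allI L2_closure_translate complex_span_translate A)
qed

lemma generator_in_generated_sis:
  assumes "\<phi> \<in> L2"
  shows "\<phi> \<in> generated_sis \<phi>"
proof -
  have "\<phi> = translate (of_int 0) \<phi>"
    by (simp add: translate_def)
  then have "\<phi> \<in> {translate (of_int j) \<phi> | j. True}"
    by blast
  then show ?thesis
    unfolding generated_sis_def
    by (intro L2_closure_superset assms subsetD[OF complex_span_superset])
qed

section \<open>Convolutions of finitely supported sequences\<close>

lemma finite_convolution_commute:
  fixes u v :: "int \<Rightarrow> 'a::comm_semiring_0"
  assumes "finite {k. u k \<noteq> 0}" "finite {k. v k \<noteq> 0}"
  shows "(\<Sum>k | v k \<noteq> 0. u (t - k) * v k) = (\<Sum>k | u k \<noteq> 0. v (t - k) * u k)"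
  by (rule sum.reindex_bij_witness_not_neutral
      [of "{k. v k \<noteq> 0 \<and> u (t - k) = 0}" "{k. u k \<noteq> 0 \<and> v (t - k) = 0}" _ "\<lambda>k. t - k" "\<lambda>k. t - k"])
    (use assms in \<open>auto simp: mult.commute\<close>)

text \<open>
  If the same convolution operators $p_m * {}$ send \<open>u\<close> to \<open>U\<close> and \<open>v\<close> to \<open>V\<close> in the limit, then
  $U * v = \lim p_m * u * v = V * u$.  This says that \<open>U\<close> is to \<open>u\<close> as \<open>V\<close> is to \<open>v\<close>, although the
  common ratio, a limit of \<open>p\<^sub>m\<close>, need not exist as a sequence.  Pointwise limits are enough because \<open>u\<close> and \<open>v\<close> are
  finitely supported.
\<close>
lemma convolution_limits_exchange:
  fixes u v U V :: "int \<Rightarrow> complex" and p :: "nat \<Rightarrow> int \<Rightarrow> complex"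
  assumes fin: "finite {k. u k \<noteq> 0}" "finite {k. v k \<noteq> 0}"
    and U: "\<And>k. (\<lambda>m. \<Sum>j\<in>P m. p m j * u (k - j)) \<longlonglongrightarrow> U k"
    and V: "\<And>k. (\<lambda>m. \<Sum>j\<in>P m. p m j * v (k - j)) \<longlonglongrightarrow> V k"
  shows "(\<Sum>k | v k \<noteq> 0. U (l - k) * v k) = (\<Sum>k | u k \<noteq> 0. V (l - k) * u k)"
proof (rule LIMSEQ_unique)
  let ?L = "\<lambda>m. \<Sum>k | v k \<noteq> 0. (\<Sum>j\<in>P m. p m j * u (l - k - j)) * v k"
  show "?L \<longlonglongrightarrow> (\<Sum>k | v k \<noteq> 0. U (l - k) * v k)"
    by (intro tendsto_intros U)
  have "?L m = (\<Sum>k | u k \<noteq> 0. (\<Sum>j\<in>P m. p m j * v (l - k - j)) * u k)" for m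
  proof -
    have *: "(\<Sum>k | w' k \<noteq> 0. (\<Sum>j\<in>P m. p m j * w (l - k - j)) * w' k)
        = (\<Sum>j\<in>P m. p m j * (\<Sum>k | w' k \<noteq> 0. w (l - j - k) * w' k))" for w w' :: "int \<Rightarrow> complex"
      by (simp add: sum_distrib_left sum_distrib_right mult.assoc sum.swap[of _ "P m"])
        (simp add: diff_diff_eq add.commute)
    show ?thesis
      unfolding * finite_convolution_commute[OF fin] ..
  qed
  then show "?L \<longlonglongrightarrow> (\<Sum>k | u k \<noteq> 0. V (l - k) * u k)"
    by (simp only:) (intro tendsto_intros V)
qed

lemma convolution_eq_fps_mult:
  fixes u v :: "int \<Rightarrow> 'a::comm_semiring_1"
  assumes "finite {k. v k \<noteq> 0}" "\<And>k. k < 0 \<Longrightarrow> u k = 0" "\<And>k. k < 0 \<Longrightarrow> v k = 0"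
  shows "(\<Sum>k | v k \<noteq> 0. u (int l - k) * v k)
    = fps_nth (Abs_fps (\<lambda>k. u (int k)) * Abs_fps (\<lambda>k. v (int k))) l"
proof -
  have "(\<Sum>k | v k \<noteq> 0. u (int l - k) * v k) = (\<Sum>k\<in>int ` {0..l}. u (int l - k) * v k)"
  proof (rule sum.mono_neutral_cong)
    fix k assume "k \<in> {k. v k \<noteq> 0} - int ` {0..l}"
    then have "k < 0 \<or> int l - k < 0"
      by (auto simp: image_iff) (metis atLeastAtMost_iff le0 linorder_not_le nat_0_le nat_le_iff)
    then show "u (int l - k) * v k = 0"
      using assms(2,3) by auto
  qed (use assms(1) in auto)
  also have "\<dots> = (\<Sum>k=0..l. v (int k) * u (int (l - k)))"
    by (simp add: sum.reindex of_nat_diff mult.commute)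
  also have "\<dots> = fps_nth (Abs_fps (\<lambda>k. v (int k)) * Abs_fps (\<lambda>k. u (int k))) l"
    by (simp add: fps_mult_nth)
  finally show ?thesis
    by (simp add: mult.commute)
qed

text \<open>
  The hypothesis says that all quotients of consecutive terms agree, so $a_n/a_0 = r^n$ with
  $r = a_1/a_0$.  If this is $X$, then the order of vanishing of $a_1^n = X a_0^n$ is both a multiple
  of \<open>n\<close> and one more than a multiple of \<open>n\<close>.
\<close>
lemma no_nth_root_of_X_in_geometric_progression:
  fixes a :: "nat \<Rightarrow> 'a::field fps"
  assumes exch: "\<And>i k. a (Suc i) * a k = a (Suc k) * a i"
    and an: "a n = fps_X * a 0" and "a 0 \<noteq> 0" "n > 1"
  shows False
proof -
  \<comment> \<open>$a_k/a_0 = (a_1/a_0)^k$ with denominators cleared\<close>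
  have pow: "a k * a 0 ^ k = a 1 ^ k * a 0" for k
  proof (induction k)
    case (Suc k)
    have "a (Suc k) * a 0 ^ Suc k = (a (Suc k) * a 0) * a 0 ^ k"
      by (simp add: mult_ac)
    also have "a (Suc k) * a 0 = a 1 * a k"
      using exch[of k 0] by simp
    also have "a 1 * a k * a 0 ^ k = a 1 ^ Suc k * a 0"
      using Suc by (simp add: mult.assoc)
    finally show ?case .
  qed simp
  have "(fps_X * a 0 ^ n) * a 0 = a 1 ^ n * a 0"
    using pow[of n] by (simp add: an mult_ac)
  then have "fps_X * a 0 ^ n = a 1 ^ n"
    using \<open>a 0 \<noteq> 0\<close> by simp
  then have "subdegree (fps_X * a 0 ^ n) = subdegree (a 1 ^ n)"
    by simp
  then have "1 + n * subdegree (a 0) = n * subdegree (a 1)"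
    using \<open>a 0 \<noteq> 0\<close> by simp
  then have "n dvd 1"
    by (metis dvd_add_left_iff dvd_triv_left)
  then show False
    using \<open>n > 1\<close> by simp
qed

section \<open>Invariance under fractional shifts\<close>

text \<open>
  The good points are those whose translates by $\frac1n\mathbb{Z}$ all lie in the set where the
  approximants converge and where \<open>\<phi>\<close> really vanishes off a bounded interval.  The base point is
  moved so far to the left that the sequences sampled from it have no terms of negative index, which
  makes them power series.
\<close>
lemma not_frac_invariant_generated_sis:
  assumes L2: "\<phi> \<in> L2" and nz: "\<not> (AE x in lebesgue. \<phi> x = 0)"
    and bdd: "bounded (ess_support \<phi>)" and "n > 1"
  shows "\<not> frac_invariant n (generated_sis \<phi>)"
proof
  assume inv: "frac_invariant n (generated_sis \<phi>)"
  let ?A = "{translate (of_int j) \<phi> | j. True}"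
  have "translate (of_int 1 / of_nat n) \<phi> \<in> generated_sis \<phi>"
    using inv generator_in_generated_sis[OF L2] unfolding frac_invariant_def by blast
  then have "translate (1 / n) \<phi> \<in> L2_closure (complex_span ?A)"
    by (simp add: generated_sis_def)
  moreover have "complex_span ?A \<subseteq> L2"
    using translate_L2[OF L2] by (intro complex_span_subset_L2) auto
  ultimately obtain g where g: "\<And>m. g m \<in> complex_span ?A"
    and lim: "AE x in lebesgue. (\<lambda>m. g m x) \<longlonglongrightarrow> translate (1 / n) \<phi> x"
    using L2_closure_AE_limit by blast
  have "\<exists>P p. finite P \<and> g m = (\<lambda>x. \<Sum>j\<in>P. p j * \<phi> (x - of_int j))" for m
    using complex_span_shifts_sum[OF g[of m]] by metis
  \<comment> \<open>The coefficients do not depend on the point \<open>x\<close>; this is what relates different grids.\<close>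
  then obtain P p where gP: "\<And>m. g m = (\<lambda>x. \<Sum>j\<in>P m. p m j * \<phi> (x - of_int j))"
    by metis
  obtain M where M: "\<And>x. x \<in> ess_support \<phi> \<Longrightarrow> \<bar>x\<bar> \<le> M"
    using bdd by (auto simp: bounded_iff)
  define good where "good x \<longleftrightarrow> (\<lambda>m. g m x) \<longlonglongrightarrow> \<phi> (x - 1 / n) \<and> (\<bar>x\<bar> > M \<longrightarrow> \<phi> x = 0)" for x
  have "AE x in lebesgue. good x"
    using lim AE_zero_outside_ess_support[of \<phi>]
    by eventually_elim (use M in \<open>force simp: good_def translate_def\<close>)
  then have "AE x in lebesgue. \<forall>i::int. good (x + i / n)"
    unfolding AE_all_countable by (intro allI AE_lebesgue_shift)
  then obtain y where y: "\<And>i::int. good (y + i / n)" "\<phi> y \<noteq> 0"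
    using nz by (metis (mono_tags, lifting) eventually_mono)
  \<comment> \<open>far enough that even the points shifted by \<open>s\<close> lie to the left of $-M$\<close>
  define s where "s = nat \<lceil>\<bar>y\<bar> + \<bar>M\<bar> + 1\<rceil>"
  have s: "real s \<ge> \<bar>y\<bar> + \<bar>M\<bar> + 1"
    unfolding s_def by linarith
  define u where "u i k = \<phi> (y - s - i / n + of_int k)" for i :: nat and k :: int
  have good: "good (y - s - i / n + of_int k)" for i :: nat and k :: int
  proof -
    have "y - s - i / n + of_int k = y + of_int ((k - int s) * int n - int i) / n"
      using \<open>n > 1\<close> by (simp add: field_simps)
    then show ?thesis
      using y(1) by metis
  qed
  have u_neg: "u i k = 0" if "k < 0" for i k
  proof -
    have "of_int k \<le> (0::real)" "real i / n \<ge> 0"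
      using that by auto
    then have "\<bar>y - s - i / n + of_int k\<bar> > M"
      using s by linarith
    then show ?thesis
      using good[of i k] by (auto simp: u_def good_def)
  qed
  have u_fin: "finite {k. u i k \<noteq> 0}" for i
  proof (rule finite_subset)
    have "\<bar>y - s - i / n + of_int k\<bar> \<le> M" if "u i k \<noteq> 0" for k
      using good[of i k] that by (force simp: u_def good_def)
    then have "of_int k \<le> M - (y - s - i / n)" if "u i k \<noteq> 0" for k
      using that by (smt (verit))
    then have "k \<le> \<lceil>M - (y - s - i / n)\<rceil>" if "u i k \<noteq> 0" for k
      using that by (smt (verit) le_of_int_ceiling of_int_le_iff)
    then show "{k. u i k \<noteq> 0} \<subseteq> {0..\<lceil>M - (y - s - i / n)\<rceil>}"
      using u_neg by (auto simp: not_less[symmetric])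
  qed simp
  \<comment> \<open>On the grids, the shift by $1/n$ is the step from \<open>u i\<close> to \<open>u (Suc i)\<close>.\<close>
  have u_lim: "(\<lambda>m. \<Sum>j\<in>P m. p m j * u i (k - j)) \<longlonglongrightarrow> u (Suc i) k" for i k
    using good[of i k] \<open>n > 1\<close> by (simp add: good_def gP u_def algebra_simps add_divide_distrib)
  define a where "a i = Abs_fps (\<lambda>k. u i (int k))" for i
  show False
  proof (rule no_nth_root_of_X_in_geometric_progression)
    show "a (Suc i) * a k = a (Suc k) * a i" for i k
    proof (rule fps_ext)
      fix l
      show "fps_nth (a (Suc i) * a k) l = fps_nth (a (Suc k) * a i) l"
        using convolution_limits_exchange[OF u_fin u_fin u_lim u_lim, of k "int l" i]
        by (simp add: convolution_eq_fps_mult u_fin u_neg a_def)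
    qed
    show "a n = fps_X * a 0"
    proof (rule fps_ext)
      fix k
      \<comment> \<open>\<open>n\<close> steps of $1/n$ are a shift by one, which maps the grid to itself\<close>
      have "u n (int k) = u 0 (int k - 1)"
        using \<open>n > 1\<close> by (simp add: u_def algebra_simps)
      then show "fps_nth (a n) k = fps_nth (fps_X * a 0) k"
        by (cases k) (simp_all add: a_def u_neg)
    qed
    have "fps_nth (a 0) s \<noteq> 0"
      using y(2) by (simp add: a_def u_def)
    then show "a 0 \<noteq> 0"
      by auto
  qed (fact \<open>n > 1\<close>)
qed

theorem proposition5p5:
  fixes \<phi> :: "real \<Rightarrow> complex"
  assumes "\<phi> \<in> L2"
    and "\<not> (AE x in lebesgue. \<phi> x = 0)"
    and "compact (ess_support \<phi>)"
  shows "invariance_order (generated_sis \<phi>) = 1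
    \<and> (\<forall>n::nat. n > 1 \<longrightarrow> \<not> frac_invariant n (generated_sis \<phi>))"
proof
  show not_inv: "\<forall>n::nat. n > 1 \<longrightarrow> \<not> frac_invariant n (generated_sis \<phi>)"
    using not_frac_invariant_generated_sis[OF assms(1,2) compact_imp_bounded[OF assms(3)]] by blast
  have "n > 0 \<and> frac_invariant n (generated_sis \<phi>) \<longleftrightarrow> n = 1" for n
    using not_inv frac_invariant_1_generated_sis[of \<phi>] by (cases "n > 1") auto
  then have "{n. n > 0 \<and> frac_invariant n (generated_sis \<phi>)} = {1}"
    by blast
  moreover have "(GREATEST n. n \<in> {1::nat}) = 1"
    by (rule Greatest_equality) auto
  ultimately show "invariance_order (generated_sis \<phi>) = 1"
    unfolding invariance_order_def Let_def by (simp add: one_enat_def)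
qed

end
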